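(* Let $m\in L^2(\Omega,\mu)$. Let $F$ and $G$ be Bessel mappings for $\mathcal{H}$ with respect to $(\Omega,\mu)$. Let $F^{(n)}$, $n\in\mathbb{N}$, be a sequence of Bessel mappings such that $F^{(n)}(\omega)\to F(\omega)$ in a uniform strong sense, i.e. for every $\epsilon>0$ there is $N$ such that $\|F^{(n)}(\omega)-F(\omega)\|\le\epsilon$ for all $n\ge N$ and all $\omega\in\Omega$. Then $\mathbf{M}_{m,F^{(n)},G}$ converges to $\mathbf{M}_{m,F,G}$ in operator norm.
   Context: $\mathcal{H}$ is a complex Hilbert space with inner product linear in the first and conjugate linear in the second variable, and $(\Omega,\mu)$ is a measure space with positive measure $\mu$. A mapping $F:\Omega\to\mathcal{H}$ is a Bessel mapping with respect to $(\Omega,\mu)$ with Bessel bound $B_F$ if $\omega\mapsto\langle f,F(\omega)\rangle$ is measurable for every $f\in\mathcal{H}$ and $\int_\Omega|\langle f,F(\omega)\rangle|^2\,d\mu(\omega)\le B_F\|f\|^2$ for all $f\in\mathcal{H}$. For Bessel mappings $F,G$ and a measurable function $m:\Omega\to\mathbb{C}$ (the symbol), the continuous Bessel multiplier $\mathbf{M}_{m,F,G}:\mathcal{H}\to\mathcal{H}$ is the operator weakly defined by $\langle\mathbf{M}_{m,F,G}f,g\rangle=\int_\Omega m(\omega)\langle f,F(\omega)\rangle\langle G(\omega),g\rangle\,d\mu(\omega)$ for all $f,g\in\mathcal{H}$. *)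

theory Defs
  imports "HOL-Analysis.Analysis"
begin

text \<open>The inner product is linear in the first and conjugate linear in the second argument.
  The metric and norm are inherited from \<^class>\<open>banach\<close>, so completeness is part of the class;
  the last axiom makes the norm the one induced by the inner product and so contains positive
  definiteness.\<close>

class complex_hilbert = banach +
  fixes scaleC :: "complex \<Rightarrow> 'a \<Rightarrow> 'a"
    and cinner :: "'a \<Rightarrow> 'a \<Rightarrow> complex"
  assumes scaleC_add_right: "scaleC a (x + y) = scaleC a x + scaleC a y"
    and scaleC_add_left: "scaleC (a + b) x = scaleC a x + scaleC b x"
    and scaleC_scaleC: "scaleC a (scaleC b x) = scaleC (a * b) x"
    and scaleC_of_real: "scaleC (complex_of_real r) x = r *\<^sub>R x"
    and cinner_commute: "cinner x y = cnj (cinner y x)"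
    and cinner_add_left: "cinner (x + y) z = cinner x z + cinner y z"
    and cinner_scaleC_left: "cinner (scaleC a x) y = a * cinner x y"
    and cinner_self: "cinner x x = complex_of_real ((norm x)\<^sup>2)"

instantiation complex :: complex_hilbert
begin

definition scaleC_complex :: "complex \<Rightarrow> complex \<Rightarrow> complex"
  where "scaleC_complex a x = a * x"

definition cinner_complex :: "complex \<Rightarrow> complex \<Rightarrow> complex"
  where "cinner_complex x y = x * cnj y"

instance
  by standard
    (auto simp: scaleC_complex_def cinner_complex_def algebra_simps scaleR_conv_of_real
      complex_norm_square simp flip: of_real_power)

end

definition square_integrable :: "'w measure \<Rightarrow> ('w \<Rightarrow> complex) \<Rightarrow> bool"
  where "square_integrable M m \<longleftrightarrow>
    m \<in> borel_measurable M \<and> integrable M (\<lambda>\<omega>. (cmod (m \<omega>))\<^sup>2)"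

definition bessel_mapping_with_bound ::
    "'w measure \<Rightarrow> ('w \<Rightarrow> 'h::complex_hilbert) \<Rightarrow> real \<Rightarrow> bool"
  where "bessel_mapping_with_bound M F B \<longleftrightarrow>
    (\<forall>f. (\<lambda>\<omega>. cinner f (F \<omega>)) \<in> borel_measurable M) \<and>
    (\<forall>f. (\<integral>\<^sup>+\<omega>. ennreal ((cmod (cinner f (F \<omega>)))\<^sup>2) \<partial>M) \<le> ennreal (B * (norm f)\<^sup>2))"

definition bessel_mapping :: "'w measure \<Rightarrow> ('w \<Rightarrow> 'h::complex_hilbert) \<Rightarrow> bool"
  where "bessel_mapping M F \<longleftrightarrow> (\<exists>B. bessel_mapping_with_bound M F B)"

text \<open>\<open>is_multiplier_value M m F G f h\<close> says that \<open>h\<close> is the value at \<open>f\<close> of the weakly defined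
  multiplier. Integrability is demanded because the Bochner integral of a non-integrable
  function is 0 by convention.\<close>

definition is_multiplier_value ::
    "'w measure \<Rightarrow> ('w \<Rightarrow> complex) \<Rightarrow> ('w \<Rightarrow> 'h) \<Rightarrow> ('w \<Rightarrow> 'h) \<Rightarrow> 'h \<Rightarrow> 'h::complex_hilbert \<Rightarrow> bool"
  where "is_multiplier_value M m F G f h \<longleftrightarrow>
    (\<forall>g. integrable M (\<lambda>\<omega>. m \<omega> * cinner f (F \<omega>) * cinner (G \<omega>) g) \<and>
         cinner h g = (LINT \<omega>|M. m \<omega> * cinner f (F \<omega>) * cinner (G \<omega>) g))"

text \<open>For an unbounded symbol (also for one in \<open>L\<^sup>2\<close>) the weak definition may fail to determine a value
  at every \<open>f\<close>, so the multiplier comes with its natural domain; it is an operator from the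
  whole space to itself iff the domain is \<^term>\<open>UNIV\<close>. Outside the domain
  \<open>multiplier\<close> is unspecified.\<close>

definition multiplier_domain ::
    "'w measure \<Rightarrow> ('w \<Rightarrow> complex) \<Rightarrow> ('w \<Rightarrow> 'h) \<Rightarrow> ('w \<Rightarrow> 'h) \<Rightarrow> 'h::complex_hilbert set"
  where "multiplier_domain M m F G = {f. \<exists>h. is_multiplier_value M m F G f h}"

definition multiplier ::
    "'w measure \<Rightarrow> ('w \<Rightarrow> complex) \<Rightarrow> ('w \<Rightarrow> 'h) \<Rightarrow> ('w \<Rightarrow> 'h) \<Rightarrow> 'h \<Rightarrow> 'h::complex_hilbert"
  where "multiplier M m F G f = (THE h. is_multiplier_value M m F G f h)"

end

theory Submission imports Defs begin

text \<open>
  The proof works with the difference \<open>D = F\<^sup>n - F\<close>. Once \<open>\<parallel>D \<omega>\<parallel> \<le> \<delta>\<close> holds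
  uniformly in \<open>\<omega>\<close>, the first coefficient satisfies \<open>\<bar>\<langle>f, D \<omega>\<rangle>\<bar> \<le> \<delta> \<parallel>f\<parallel>\<close> pointwise, so the weight
  \<open>m\<close> is paired only with the square integrable function \<open>\<langle>G \<omega>, g\<rangle>\<close>. The sesquilinear form
  \<open>\<integral> m \<langle>f, D\<rangle> \<langle>G, g\<rangle>\<close> is therefore defined for \<^emph>\<open>all\<close> \<open>f\<close> and \<open>g\<close>, and it is bounded by
  \<open>\<delta> K \<parallel>f\<parallel> \<parallel>g\<parallel>\<close> with \<open>K\<close> depending on \<open>m\<close> and \<open>G\<close> only (\<open>pairing_bound\<close>). By the Riesz
  representation theorem (\<open>riesz_antilinear\<close>) the multiplier of \<open>D\<close> is defined everywhere and has
  norm at most \<open>\<delta> K\<close> (\<open>multiplier_of_small_mapping\<close>).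

  Multiplier values are additive in the analysing mapping, and \<open>F\<^sup>n = F + D\<close>, \<open>F = F\<^sup>n - D\<close>. Hence
  \<open>F\<^sup>n\<close> and \<open>F\<close> give the same domain, although neither multiplier need be bounded or everywhere
  defined, and on this domain the two multipliers differ exactly by the multiplier of \<open>D\<close>
  (\<open>multiplier_perturbation\<close>).

  The Riesz theorem is obtained by minimising \<open>\<parallel>x\<parallel>\<^sup>2 - 2 \<phi> x\<close>: the parallelogram law makes
  minimising sequences Cauchy, and stationarity at the minimum is the representation formula.
\<close>

section \<open>Inner product algebra\<close>

lemma cinner_add_right: "cinner x (y + z) = cinner x y + cinner x (z :: 'h::complex_hilbert)"
  by (metis cinner_add_left cinner_commute complex_cnj_add)

lemma cinner_scaleC_right: "cinner x (scaleC a y) = cnj a * cinner x (y :: 'h::complex_hilbert)"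
  by (metis cinner_scaleC_left cinner_commute complex_cnj_mult)

lemma cinner_scaleR_left: "cinner (r *\<^sub>R x) y = of_real r * cinner x (y :: 'h::complex_hilbert)"
  by (metis cinner_scaleC_left scaleC_of_real)

lemma cinner_scaleR_right: "cinner x (r *\<^sub>R y) = of_real r * cinner x (y :: 'h::complex_hilbert)"
  by (metis cinner_scaleC_right scaleC_of_real complex_cnj_complex_of_real)

lemma cinner_minus_left: "cinner (- x) y = - cinner x (y :: 'h::complex_hilbert)"
  using cinner_scaleR_left[of "-1" x y] by simp

lemma cinner_minus_right: "cinner x (- y) = - cinner x (y :: 'h::complex_hilbert)"
  using cinner_scaleR_right[of x "-1" y] by simp

lemma cinner_diff_left: "cinner (x - y) z = cinner x z - cinner y (z :: 'h::complex_hilbert)"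
  using cinner_add_left[of x "- y" z] by (simp add: cinner_minus_left)

lemma cinner_diff_right: "cinner x (y - z) = cinner x y - cinner x (z :: 'h::complex_hilbert)"
  using cinner_add_right[of x y "- z"] by (simp add: cinner_minus_right)

lemma cinner_zero_right [simp]: "cinner x (0 :: 'h::complex_hilbert) = 0"
  using cinner_scaleR_right[of x 0 0] by simp

lemma cmod_cinner_commute: "cmod (cinner x y) = cmod (cinner y (x :: 'h::complex_hilbert))"
  by (metis cinner_commute complex_mod_cnj)

lemma cinner_ext:
  fixes x y :: "'h::complex_hilbert"
  assumes "\<And>g. cinner x g = cinner y g"
  shows "x = y"
proof -
  have "cinner (x - y) (x - y) = 0"
    using assms[of "x - y"] by (simp add: cinner_diff_left)
  then show ?thesis by (simp add: cinner_self)
qed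

lemma norm_add_sq:
  "(norm (x + y))\<^sup>2 = (norm x)\<^sup>2 + 2 * Re (cinner x y) + (norm (y :: 'h::complex_hilbert))\<^sup>2"
proof -
  have "Re (cinner y x) = Re (cinner x y)"
    by (subst cinner_commute) simp
  moreover have "complex_of_real ((norm (x + y))\<^sup>2)
      = cinner x x + cinner x y + cinner y x + cinner y y"
    unfolding cinner_self[symmetric] by (simp add: cinner_add_left cinner_add_right)
  ultimately show ?thesis
    by (auto simp: cinner_self complex_eq_iff simp flip: of_real_power)
qed

lemma parallelogram_law:
  "(norm (x + y))\<^sup>2 + (norm (x - y))\<^sup>2 = 2 * (norm x)\<^sup>2 + 2 * (norm (y :: 'h::complex_hilbert))\<^sup>2"
  using norm_add_sq[of x y] norm_add_sq[of x "- y"] by (simp add: cinner_minus_right)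

lemma norm_scaleC: "norm (scaleC a x) = cmod a * norm (x :: 'h::complex_hilbert)"
proof -
  have "cinner (scaleC a x) (scaleC a x) = (a * cnj a) * cinner x x"
    by (simp add: cinner_scaleC_left cinner_scaleC_right)
  then have "complex_of_real ((norm (scaleC a x))\<^sup>2) = of_real ((cmod a * norm x)\<^sup>2)"
    by (simp only: cinner_self complex_norm_square[symmetric] power_mult_distrib of_real_mult
        of_real_power)
  then have "(norm (scaleC a x))\<^sup>2 = (cmod a * norm x)\<^sup>2"
    using of_real_eq_iff by blast
  then show ?thesis by (simp add: power2_eq_iff_nonneg)
qed

text \<open>The triangle inequality is part of the class axioms, and it already contains the real part of
  the Cauchy-Schwarz inequality; a rotation of \<open>x\<close> makes the inner product real.\<close>

lemma cmod_cinner_le: "cmod (cinner x y) \<le> norm x * norm (y :: 'h::complex_hilbert)"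
proof -
  have re: "Re (cinner u y) \<le> norm u * norm y" for u :: 'h
  proof -
    have "(norm (u + y))\<^sup>2 \<le> (norm u + norm y)\<^sup>2"
      by (intro power_mono norm_triangle_ineq) auto
    then show ?thesis unfolding norm_add_sq by (simp add: power2_sum)
  qed
  define a where "a = cnj (sgn (cinner x y))"
  have "a * cinner x y = of_real (cmod (cinner x y))"
    by (simp add: a_def sgn_eq complex_norm_square[symmetric] mult.commute[of _ "cnj _"]
        field_simps power2_eq_square)
  then have "cmod (cinner x y) = Re (cinner (scaleC a x) y)"
    by (simp add: cinner_scaleC_left)
  also have "\<dots> \<le> norm (scaleC a x) * norm y" by (rule re)
  also have "\<dots> \<le> 1 * norm x * norm y"
    by (intro mult_right_mono) (auto simp: norm_scaleC a_def norm_sgn)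
  finally show ?thesis by simp
qed

section \<open>The Riesz representation theorem\<close>

text \<open>The minimiser of \<open>J x = \<parallel>x\<parallel>\<^sup>2 - 2 \<phi> x\<close> represents \<open>\<phi>\<close>. It exists because of the identity
  \<open>\<parallel>x - y\<parallel>\<^sup>2 = 2 J x + 2 J y - 4 J ((x + y) / 2)\<close>, which bounds the distance of two points by how
  far they are from being optimal.\<close>

lemma riesz_real:
  fixes \<phi> :: "'h::complex_hilbert \<Rightarrow> real"
  assumes "bounded_linear \<phi>"
  shows "\<exists>h. \<forall>g. Re (cinner h g) = \<phi> g"
proof -
  interpret bounded_linear \<phi> by fact
  obtain C where C: "\<And>x. \<bar>\<phi> x\<bar> \<le> norm x * C"
    using bounded by (auto simp: real_norm_def)
  define J where "J x = (norm x)\<^sup>2 - 2 * \<phi> x" for x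
  have lower: "- C\<^sup>2 \<le> J x" for x
  proof -
    have "0 \<le> (norm x - C)\<^sup>2" by simp
    then show ?thesis using C[of x] unfolding J_def
      by (simp add: power2_diff)
  qed
  define I where "I = Inf (range J)"
  have bdd: "bdd_below (range J)" using lower by (rule bdd_belowI2)
  have IJ: "I \<le> J x" for x unfolding I_def by (rule cInf_lower[OF _ bdd]) auto
  have "\<exists>x. J x < I + inverse (real (Suc n))" for n
  proof -
    have "Inf (range J) < I + inverse (real (Suc n))" by (simp add: I_def)
    then show ?thesis using cInf_less_iff[OF _ bdd] by auto
  qed
  then obtain X where X: "\<And>n. J (X n) < I + inverse (real (Suc n))" by metis
  have dist: "(norm (x - y))\<^sup>2 \<le> 2 * (J x - I) + 2 * (J y - I)" for x y
  proof -
    have "J ((1/2) *\<^sub>R (x + y)) = (norm (x + y))\<^sup>2 / 4 - \<phi> x - \<phi> y"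
      unfolding J_def norm_scaleR
      by (simp add: scaleR add power_mult_distrib power_divide) (simp add: field_simps)
    then show ?thesis
      using IJ[of "(1/2) *\<^sub>R (x + y)"] parallelogram_law[of x y] by (simp add: J_def)
  qed
  have "Cauchy X"
  proof (rule CauchyI)
    fix e :: real assume "0 < e"
    then obtain N where N: "inverse (real (Suc N)) < e\<^sup>2 / 4"
      using reals_Archimedean[of "e\<^sup>2 / 4"] by auto
    have close: "J (X n) - I < e\<^sup>2 / 4" if "N \<le> n" for n
    proof -
      have "inverse (real (Suc n)) \<le> inverse (real (Suc N))" using that by (simp add: le_imp_inverse_le)
      then show ?thesis using X[of n] N by linarith
    qed
    have "norm (X i - X j) < e" if "N \<le> i" "N \<le> j" for i j
    proof -
      have "(norm (X i - X j))\<^sup>2 < e\<^sup>2"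
        using dist[of "X i" "X j"] close[OF that(1)] close[OF that(2)] by (simp add: field_simps)
      then show ?thesis using \<open>0 < e\<close> by (simp add: power_less_imp_less_base)
    qed
    then show "\<exists>N. \<forall>i\<ge>N. \<forall>j\<ge>N. norm (X i - X j) < e" by blast
  qed
  then obtain h where h: "X \<longlonglongrightarrow> h" by (meson Cauchy_convergent convergentD)
  have "(\<lambda>n. J (X n)) \<longlonglongrightarrow> J h"
    unfolding J_def by (intro tendsto_intros h tendsto)
  moreover have "(\<lambda>n. I + inverse (real (Suc n))) \<longlonglongrightarrow> I + 0"
    by (intro tendsto_intros LIMSEQ_inverse_real_of_nat)
  ultimately have "J h \<le> I + 0"
    by (rule LIMSEQ_le) (use X less_imp_le in blast)
  then have min: "J h \<le> J x" for x using IJ[of x] by linarith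
  have "Re (cinner h g) = \<phi> g" for g
  proof -
    define a where "a = Re (cinner h g) - \<phi> g"
    define N where "N = (norm g)\<^sup>2"
    have "N \<ge> 0" by (simp add: N_def)
    have quad: "0 \<le> 2 * t * a + t\<^sup>2 * N" for t
    proof -
      have "J (h + t *\<^sub>R g) = J h + 2 * t * a + t\<^sup>2 * N"
        unfolding J_def N_def a_def norm_add_sq
        by (simp add: cinner_scaleR_right scaleR add power_mult_distrib algebra_simps)
      then show ?thesis using min[of "h + t *\<^sub>R g"] by linarith
    qed
    \<comment> \<open>The test point is \<open>- a / (N + 1)\<close>, not the vertex \<open>- a / N\<close>, so as to cover \<open>g = 0\<close>.\<close>
    define s where "s = a / (N + 1)"
    have a: "a = s * (N + 1)" using \<open>N \<ge> 0\<close> by (simp add: s_def)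
    have "s\<^sup>2 * (N + 2) \<le> 0"
      using quad[of "- s"] by (simp add: a algebra_simps power2_eq_square)
    then have "a = 0" using \<open>N \<ge> 0\<close> by (simp add: a mult_le_0_iff)
    then show ?thesis by (simp add: a_def)
  qed
  then show ?thesis by blast
qed

text \<open>An antilinear functional is determined by its real part, since its imaginary part at \<open>g\<close> is
  its real part at \<open>\<i> g\<close>; so the real version suffices.\<close>

lemma riesz_antilinear:
  fixes \<psi> :: "'h::complex_hilbert \<Rightarrow> complex"
  assumes add: "\<And>x y. \<psi> (x + y) = \<psi> x + \<psi> y"
    and scale: "\<And>a x. \<psi> (scaleC a x) = cnj a * \<psi> x"
    and bound: "\<And>x. cmod (\<psi> x) \<le> C * norm x"
    and "0 \<le> C"
  shows "\<exists>h. (\<forall>g. cinner h g = \<psi> g) \<and> norm h \<le> C"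
proof -
  have "bounded_linear (\<lambda>x. Re (\<psi> x))"
  proof (rule bounded_linear_intro[where K = C])
    show "Re (\<psi> (r *\<^sub>R x)) = r *\<^sub>R Re (\<psi> x)" for r x
      using scale[of "of_real r" x] by (simp add: scaleC_of_real)
    show "norm (Re (\<psi> x)) \<le> norm x * C" for x
      using bound[of x] abs_Re_le_cmod[of "\<psi> x"] by (simp add: mult.commute)
  qed (simp add: add)
  then obtain h where h: "\<And>g. Re (cinner h g) = Re (\<psi> g)"
    using riesz_real by blast
  have eq: "cinner h g = \<psi> g" for g
    using h[of g] h[of "scaleC \<i> g"] by (simp add: scale cinner_scaleC_right complex_eq_iff)
  have "(norm h)\<^sup>2 \<le> C * norm h"
    using bound[of h] by (simp add: eq[symmetric] cinner_self norm_power)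
  then have "norm h \<le> C"
    using \<open>0 \<le> C\<close> by (cases "h = 0") (auto simp: power2_eq_square)
  with eq show ?thesis by blast
qed

section \<open>Multiplier values\<close>

lemma is_multiplier_value_unique:
  assumes "is_multiplier_value M m F G f h" "is_multiplier_value M m F G f h'"
  shows "h = h'"
  by (rule cinner_ext) (use assms in \<open>simp add: is_multiplier_value_def\<close>)

lemma multiplier_eq:
  assumes "is_multiplier_value M m F G f h"
  shows "multiplier M m F G f = h"
  unfolding multiplier_def
  using assms by (rule the_equality) (rule is_multiplier_value_unique[OF _ assms])

lemma is_multiplier_value_add_mapping:
  assumes "is_multiplier_value M m F1 G f h1" "is_multiplier_value M m F2 G f h2"
  shows "is_multiplier_value M m (\<lambda>\<omega>. F1 \<omega> + F2 \<omega>) G f (h1 + h2)"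
proof -
  have "(\<lambda>\<omega>. m \<omega> * cinner f (F1 \<omega> + F2 \<omega>) * cinner (G \<omega>) g)
    = (\<lambda>\<omega>. m \<omega> * cinner f (F1 \<omega>) * cinner (G \<omega>) g
      + m \<omega> * cinner f (F2 \<omega>) * cinner (G \<omega>) g)" for g
    by (simp add: cinner_add_right algebra_simps)
  then show ?thesis
    using assms by (simp add: is_multiplier_value_def cinner_add_left)
qed

lemma is_multiplier_value_diff_mapping:
  assumes "is_multiplier_value M m F1 G f h1" "is_multiplier_value M m F2 G f h2"
  shows "is_multiplier_value M m (\<lambda>\<omega>. F1 \<omega> - F2 \<omega>) G f (h1 - h2)"
proof -
  have "(\<lambda>\<omega>. m \<omega> * cinner f (F1 \<omega> - F2 \<omega>) * cinner (G \<omega>) g)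
    = (\<lambda>\<omega>. m \<omega> * cinner f (F1 \<omega>) * cinner (G \<omega>) g
      - m \<omega> * cinner f (F2 \<omega>) * cinner (G \<omega>) g)" for g
    by (simp add: cinner_diff_right algebra_simps)
  then show ?thesis
    using assms by (simp add: is_multiplier_value_def cinner_diff_left)
qed

lemma is_multiplier_value_add:
  assumes "is_multiplier_value M m F G f1 h1" "is_multiplier_value M m F G f2 h2"
  shows "is_multiplier_value M m F G (f1 + f2) (h1 + h2)"
proof -
  have "(\<lambda>\<omega>. m \<omega> * cinner (f1 + f2) (F \<omega>) * cinner (G \<omega>) g)
    = (\<lambda>\<omega>. m \<omega> * cinner f1 (F \<omega>) * cinner (G \<omega>) g
      + m \<omega> * cinner f2 (F \<omega>) * cinner (G \<omega>) g)" for g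
    by (simp add: cinner_add_left algebra_simps)
  then show ?thesis
    using assms by (simp add: is_multiplier_value_def cinner_add_left[of h1 h2])
qed

lemma is_multiplier_value_scaleR:
  assumes "is_multiplier_value M m F G f h"
  shows "is_multiplier_value M m F G (r *\<^sub>R f) (r *\<^sub>R h)"
proof -
  have "(\<lambda>\<omega>. m \<omega> * cinner (r *\<^sub>R f) (F \<omega>) * cinner (G \<omega>) g)
    = (\<lambda>\<omega>. of_real r * (m \<omega> * cinner f (F \<omega>) * cinner (G \<omega>) g))" for g
    by (simp add: cinner_scaleR_left algebra_simps)
  then show ?thesis
    using assms by (simp add: is_multiplier_value_def cinner_scaleR_left[of r h])
qed

section \<open>The multiplier of a uniformly small mapping\<close>

text \<open>Young's inequality, weighted by \<open>\<parallel>g\<parallel>\<close>, replaces Cauchy-Schwarz in \<open>L\<^sup>2\<close>; it gives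
  \<open>K = (\<parallel>m\<parallel>\<^sup>2 + B) / 2\<close> for a nonnegative Bessel bound \<open>B\<close> of \<open>G\<close>. Only linearity in \<open>\<parallel>g\<parallel>\<close> matters below,
  not the sharp constant.\<close>

lemma pairing_bound:
  assumes m: "square_integrable M m" and G: "bessel_mapping M G"
  obtains K where "0 \<le> K"
    and "\<And>g. integrable M (\<lambda>\<omega>. cmod (m \<omega>) * cmod (cinner (G \<omega>) g))"
    and "\<And>g. (LINT \<omega>|M. cmod (m \<omega>) * cmod (cinner (G \<omega>) g)) \<le> K * norm g"
proof -
  obtain B0 where B0: "bessel_mapping_with_bound M G B0"
    using G by (auto simp: bessel_mapping_def)
  define B where "B = max 0 B0"
  define A where "A = (LINT \<omega>|M. (cmod (m \<omega>))\<^sup>2)"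
  have [measurable]: "m \<in> borel_measurable M" and mi: "integrable M (\<lambda>\<omega>. (cmod (m \<omega>))\<^sup>2)"
    using m by (auto simp: square_integrable_def)
  have "0 \<le> A" "0 \<le> B" by (auto simp: A_def B_def)
  have Gm [measurable]: "(\<lambda>\<omega>. cmod (cinner (G \<omega>) g)) \<in> borel_measurable M" for g
  proof -
    have [measurable]: "(\<lambda>\<omega>. cinner g (G \<omega>)) \<in> borel_measurable M"
      using B0 by (simp add: bessel_mapping_with_bound_def)
    show ?thesis by (subst cmod_cinner_commute) measurable
  qed
  have bnd: "(\<integral>\<^sup>+\<omega>. ennreal ((cmod (cinner (G \<omega>) g))\<^sup>2) \<partial>M) \<le> ennreal (B * (norm g)\<^sup>2)" for g
  proof -
    have "(\<integral>\<^sup>+\<omega>. ennreal ((cmod (cinner (G \<omega>) g))\<^sup>2) \<partial>M) \<le> ennreal (B0 * (norm g)\<^sup>2)"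
      using B0 by (subst cmod_cinner_commute) (simp add: bessel_mapping_with_bound_def)
    also have "\<dots> \<le> ennreal (B * (norm g)\<^sup>2)"
      by (intro ennreal_leI mult_right_mono) (auto simp: B_def)
    finally show ?thesis .
  qed
  have Gi: "integrable M (\<lambda>\<omega>. (cmod (cinner (G \<omega>) g))\<^sup>2)" for g
  proof (rule integrableI_bounded)
    show "(\<integral>\<^sup>+\<omega>. ennreal (norm ((cmod (cinner (G \<omega>) g))\<^sup>2)) \<partial>M) < \<infinity>"
      using bnd[of g] le_less_trans by fastforce
  qed simp
  have Gle: "(LINT \<omega>|M. (cmod (cinner (G \<omega>) g))\<^sup>2) \<le> B * (norm g)\<^sup>2" for g
    using bnd[of g] \<open>0 \<le> B\<close> by (subst (asm) nn_integral_eq_integral[OF Gi]) auto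
  define K where "K = (A + B) / 2"
  have main: "integrable M (\<lambda>\<omega>. cmod (m \<omega>) * cmod (cinner (G \<omega>) g)) \<and>
      (LINT \<omega>|M. cmod (m \<omega>) * cmod (cinner (G \<omega>) g)) \<le> K * norm g" for g
  proof (cases "g = 0")
    case False
    define c where "c = norm g"
    have "c > 0" using False by (simp add: c_def)
    define Y where "Y \<omega> = (c * (cmod (m \<omega>))\<^sup>2 + (cmod (cinner (G \<omega>) g))\<^sup>2 / c) / 2" for \<omega>
    have Yi: "integrable M Y" unfolding Y_def using mi Gi[of g] by simp
    have young: "cmod (m \<omega>) * cmod (cinner (G \<omega>) g) \<le> Y \<omega>" for \<omega>
    proof -
      have "0 \<le> (c * cmod (m \<omega>) - cmod (cinner (G \<omega>) g))\<^sup>2" by simp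
      then show ?thesis unfolding Y_def using \<open>c > 0\<close>
        by (simp add: field_simps power2_eq_square)
    qed
    have int: "integrable M (\<lambda>\<omega>. cmod (m \<omega>) * cmod (cinner (G \<omega>) g))"
    proof (rule Bochner_Integration.integrable_bound[OF Yi])
      show "AE \<omega> in M. norm (cmod (m \<omega>) * cmod (cinner (G \<omega>) g)) \<le> norm (Y \<omega>)"
      proof (rule AE_I2)
        show "norm (cmod (m \<omega>) * cmod (cinner (G \<omega>) g)) \<le> norm (Y \<omega>)" for \<omega>
          using young[of \<omega>] by (simp add: abs_mult)
      qed
    qed simp
    have "(LINT \<omega>|M. cmod (m \<omega>) * cmod (cinner (G \<omega>) g)) \<le> integral\<^sup>L M Y"
      by (rule integral_mono[OF int Yi young])
    also have "\<dots> = (c * A + (LINT \<omega>|M. (cmod (cinner (G \<omega>) g))\<^sup>2) / c) / 2"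
      unfolding Y_def A_def using mi Gi[of g] by simp
    also have "\<dots> \<le> (c * A + B * c\<^sup>2 / c) / 2"
      using Gle[of g] \<open>c > 0\<close> by (simp add: c_def divide_right_mono)
    also have "\<dots> = K * norm g"
      using \<open>c > 0\<close> by (simp add: K_def c_def[symmetric] field_simps power2_eq_square)
    finally show ?thesis using int by simp
  qed simp
  show thesis
    by (rule that[of K]) (use main \<open>0 \<le> A\<close> \<open>0 \<le> B\<close> in \<open>auto simp: K_def\<close>)
qed

text \<open>A uniform bound on \<open>D\<close> makes the coefficient \<open>\<langle>f, D \<omega>\<rangle>\<close> bounded, so that every \<open>f\<close>, and not
  just those in a smaller domain, has a multiplier value.\<close>

lemma multiplier_of_small_mapping:
  fixes D G :: "'w \<Rightarrow> 'h::complex_hilbert"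
  assumes m: "m \<in> borel_measurable M"
    and Gm: "\<And>g. (\<lambda>\<omega>. cinner g (G \<omega>)) \<in> borel_measurable M"
    and "0 \<le> K"
    and Ki: "\<And>g. integrable M (\<lambda>\<omega>. cmod (m \<omega>) * cmod (cinner (G \<omega>) g))"
    and K: "\<And>g. (LINT \<omega>|M. cmod (m \<omega>) * cmod (cinner (G \<omega>) g)) \<le> K * norm g"
    and D: "(\<lambda>\<omega>. cinner f (D \<omega>)) \<in> borel_measurable M"
    and "0 \<le> \<delta>" and small: "\<And>\<omega>. \<omega> \<in> space M \<Longrightarrow> norm (D \<omega>) \<le> \<delta>"
  shows "\<exists>h. is_multiplier_value M m D G f h \<and> norm h \<le> \<delta> * K * norm f"
proof -
  let ?u = "\<lambda>g \<omega>. m \<omega> * cinner f (D \<omega>) * cinner (G \<omega>) g"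
  let ?v = "\<lambda>g \<omega>. (\<delta> * norm f) * (cmod (m \<omega>) * cmod (cinner (G \<omega>) g))"
  have [measurable]: "(\<lambda>\<omega>. cinner (G \<omega>) g) \<in> borel_measurable M" for g
  proof -
    have "(\<lambda>\<omega>. cnj (cinner g (G \<omega>))) \<in> borel_measurable M"
      using borel_measurable_continuous_onI[OF continuous_on_cnj[OF continuous_on_id]]
      by (rule measurable_compose[OF Gm])
    then show ?thesis by (simp flip: cinner_commute)
  qed
  have le: "norm (?u g \<omega>) \<le> ?v g \<omega>" if "\<omega> \<in> space M" for g \<omega>
  proof -
    have "cmod (cinner f (D \<omega>)) \<le> norm f * norm (D \<omega>)" by (rule cmod_cinner_le)
    also have "\<dots> \<le> norm f * \<delta>" using small[OF that] by (intro mult_left_mono) auto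
    finally have "cmod (cinner f (D \<omega>)) * (cmod (m \<omega>) * cmod (cinner (G \<omega>) g)) \<le> ?v g \<omega>"
      by (intro mult_right_mono) (auto simp: mult.commute)
    then show ?thesis by (simp add: norm_mult mult_ac)
  qed
  have vi: "integrable M (?v g)" for g using Ki[of g] by simp
  have ui: "integrable M (?u g)" for g
  proof (rule Bochner_Integration.integrable_bound[OF vi[of g]])
    show "?u g \<in> borel_measurable M" using m D by measurable
    show "AE \<omega> in M. norm (?u g \<omega>) \<le> norm (?v g \<omega>)"
      using le[of _ g] by (intro AE_I2) (smt (verit) real_norm_def)
  qed
  define \<psi> where "\<psi> g = integral\<^sup>L M (?u g)" for g
  have "\<exists>h. (\<forall>g. cinner h g = \<psi> g) \<and> norm h \<le> \<delta> * K * norm f"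
  proof (rule riesz_antilinear)
    show "\<psi> (x + y) = \<psi> x + \<psi> y" for x y
      unfolding \<psi>_def using ui[of x] ui[of y] by (simp add: cinner_add_right distrib_left)
    show "\<psi> (scaleC a x) = cnj a * \<psi> x" for a x
    proof -
      have "?u (scaleC a x) = (\<lambda>\<omega>. cnj a * ?u x \<omega>)" by (simp add: cinner_scaleC_right mult_ac)
      then show ?thesis unfolding \<psi>_def by (simp only: integral_mult_right_zero)
    qed
    show "cmod (\<psi> g) \<le> \<delta> * K * norm f * norm g" for g
    proof -
      have "cmod (\<psi> g) \<le> integral\<^sup>L M (?v g)"
        unfolding \<psi>_def using integral_norm_bound[of M "?u g"]
          integral_mono[OF integrable_norm[OF ui[of g]] vi[of g] le[of _ g]] by linarith
      also have "\<dots> = (\<delta> * norm f) * (LINT \<omega>|M. cmod (m \<omega>) * cmod (cinner (G \<omega>) g))" by simp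
      also have "\<dots> \<le> (\<delta> * norm f) * (K * norm g)"
        using K[of g] \<open>0 \<le> \<delta>\<close> by (intro mult_left_mono) auto
      finally show ?thesis by (simp add: mult_ac)
    qed
    show "0 \<le> \<delta> * K * norm f" using \<open>0 \<le> \<delta>\<close> \<open>0 \<le> K\<close> by simp
  qed
  then show ?thesis using ui by (auto simp: is_multiplier_value_def \<psi>_def)
qed

section \<open>Perturbation of the analysing mapping\<close>

text \<open>If the multiplier of \<open>F' - F\<close> is defined everywhere, then adding it to, or subtracting it from,
  a value for \<open>F\<close> or \<open>F'\<close> turns one into the other.\<close>

lemma multiplier_perturbation:
  assumes "\<And>f. is_multiplier_value M m (\<lambda>\<omega>. F' \<omega> - F \<omega>) G f (T f)"
  shows "multiplier_domain M m F' G = multiplier_domain M m F G"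
    and "f \<in> multiplier_domain M m F G \<Longrightarrow>
      multiplier M m F' G f - multiplier M m F G f = T f"
proof -
  have up: "is_multiplier_value M m F' G f (h + T f)" if "is_multiplier_value M m F G f h" for f h
    using is_multiplier_value_add_mapping[OF that assms] by simp
  have down: "is_multiplier_value M m F G f (h - T f)" if "is_multiplier_value M m F' G f h" for f h
    using is_multiplier_value_diff_mapping[OF that assms] by simp
  show "multiplier_domain M m F' G = multiplier_domain M m F G"
    unfolding multiplier_domain_def using up down by blast
  show "multiplier M m F' G f - multiplier M m F G f = T f" if f: "f \<in> multiplier_domain M m F G"
  proof -
    obtain h where h: "is_multiplier_value M m F G f h"
      using f by (auto simp: multiplier_domain_def)
    show ?thesis using multiplier_eq[OF h] multiplier_eq[OF up[OF h]] by simp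
  qed
qed

text \<open>Everything is read off from one eventual statement: for each \<open>\<epsilon>\<close>, all but finitely many
  \<open>F\<^sup>n - F\<close> have an everywhere defined multiplier \<open>T\<close> of norm at most \<open>\<epsilon>\<close>.\<close>

theorem theorem3p13:
  fixes M :: "'w measure"
    and m :: "'w \<Rightarrow> complex"
    and F G :: "'w \<Rightarrow> 'h::complex_hilbert"
    and Fn :: "nat \<Rightarrow> 'w \<Rightarrow> 'h"
  assumes "square_integrable M m"
    and "bessel_mapping M F"
    and "bessel_mapping M G"
    and "\<And>n. bessel_mapping M (Fn n)"
    and "\<forall>\<epsilon>>0. \<exists>N. \<forall>n\<ge>N. \<forall>\<omega>\<in>space M. norm (Fn n \<omega> - F \<omega>) \<le> \<epsilon>"
  shows "(\<forall>\<epsilon>>0. \<forall>\<^sub>F n in sequentially.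
            multiplier_domain M m (Fn n) G = multiplier_domain M m F G \<and>
            (\<forall>f \<in> multiplier_domain M m F G.
               norm (multiplier M m (Fn n) G f - multiplier M m F G f) \<le> \<epsilon> * norm f)) \<and>
         (multiplier_domain M m F G = UNIV \<longrightarrow>
            (\<forall>\<^sub>F n in sequentially.
               multiplier_domain M m (Fn n) G = UNIV \<and>
               bounded_linear (\<lambda>f. multiplier M m (Fn n) G f - multiplier M m F G f)) \<and>
            (\<lambda>n. onorm (\<lambda>f. multiplier M m (Fn n) G f - multiplier M m F G f)) \<longlonglongrightarrow> 0)"
proof -
  have m: "m \<in> borel_measurable M" using assms(1) by (simp add: square_integrable_def)
  have meas: "(\<lambda>\<omega>. cinner g (H \<omega>)) \<in> borel_measurable M" if "bessel_mapping M H" for H :: "'w \<Rightarrow> 'h" and g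
    using that by (auto simp: bessel_mapping_def bessel_mapping_with_bound_def)
  obtain K where "0 \<le> K"
    and K: "\<And>g. integrable M (\<lambda>\<omega>. cmod (m \<omega>) * cmod (cinner (G \<omega>) g))"
      "\<And>g. (LINT \<omega>|M. cmod (m \<omega>) * cmod (cinner (G \<omega>) g)) \<le> K * norm g"
    using pairing_bound[OF assms(1,3)] by blast
  have ev: "\<forall>\<^sub>F n in sequentially. \<exists>T. \<forall>f.
      is_multiplier_value M m (\<lambda>\<omega>. Fn n \<omega> - F \<omega>) G f (T f) \<and> norm (T f) \<le> \<epsilon> * norm f"
    if "\<epsilon> > 0" for \<epsilon>
  proof -
    \<comment> \<open>The denominator \<open>K + 1\<close> keeps \<open>\<delta>\<close> positive and finite when \<open>K = 0\<close>.\<close>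
    define \<delta> where "\<delta> = \<epsilon> / (K + 1)"
    have "\<delta> > 0" using that \<open>0 \<le> K\<close> by (simp add: \<delta>_def)
    have \<delta>K: "\<delta> * K \<le> \<epsilon>" using that \<open>0 \<le> K\<close> by (simp add: \<delta>_def field_simps)
    obtain N where N: "\<And>n \<omega>. N \<le> n \<Longrightarrow> \<omega> \<in> space M \<Longrightarrow> norm (Fn n \<omega> - F \<omega>) \<le> \<delta>"
      using assms(5) \<open>\<delta> > 0\<close> by meson
    have "\<exists>h. is_multiplier_value M m (\<lambda>\<omega>. Fn n \<omega> - F \<omega>) G f h \<and> norm h \<le> \<epsilon> * norm f"
      if n: "N \<le> n" for n f
    proof -
      have D: "(\<lambda>\<omega>. cinner f (Fn n \<omega> - F \<omega>)) \<in> borel_measurable M"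
        using meas[OF assms(4)] meas[OF assms(2)] by (simp add: cinner_diff_right)
      obtain h where h: "is_multiplier_value M m (\<lambda>\<omega>. Fn n \<omega> - F \<omega>) G f h"
          and "norm h \<le> \<delta> * K * norm f"
        using multiplier_of_small_mapping[OF m meas[OF assms(3)] \<open>0 \<le> K\<close> K D
            less_imp_le[OF \<open>\<delta> > 0\<close>] N[OF n]]
        by blast
      note this(2)
      also have "\<delta> * K * norm f \<le> \<epsilon> * norm f" by (rule mult_right_mono[OF \<delta>K norm_ge_zero])
      finally show ?thesis using h by blast
    qed
    then have "\<forall>n\<ge>N. \<exists>T. \<forall>f.
        is_multiplier_value M m (\<lambda>\<omega>. Fn n \<omega> - F \<omega>) G f (T f) \<and> norm (T f) \<le> \<epsilon> * norm f"
      by (intro allI impI choice) blast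
    then show ?thesis unfolding eventually_sequentially by blast
  qed
  let ?\<Delta> = "\<lambda>n f. multiplier M m (Fn n) G f - multiplier M m F G f"
  have conv: "\<forall>\<^sub>F n in sequentially. multiplier_domain M m (Fn n) G = multiplier_domain M m F G \<and>
      (\<forall>f \<in> multiplier_domain M m F G. norm (?\<Delta> n f) \<le> \<epsilon> * norm f)" if "\<epsilon> > 0" for \<epsilon>
    using ev[OF that]
  proof eventually_elim
    case (elim n)
    then obtain T where T: "\<And>f. is_multiplier_value M m (\<lambda>\<omega>. Fn n \<omega> - F \<omega>) G f (T f)"
      and bound: "\<And>f. norm (T f) \<le> \<epsilon> * norm f" by blast
    show ?case
      by (intro conjI ballI) (simp_all only: multiplier_perturbation[OF T] bound)
  qed
  have lin: "\<forall>\<^sub>F n in sequentially.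
      multiplier_domain M m (Fn n) G = UNIV \<and> bounded_linear (?\<Delta> n) \<and> onorm (?\<Delta> n) \<le> \<epsilon>"
    if full: "multiplier_domain M m F G = UNIV" and "\<epsilon> > 0" for \<epsilon>
    using ev[OF \<open>\<epsilon> > 0\<close>]
  proof eventually_elim
    case (elim n)
    then obtain T where T: "\<And>f. is_multiplier_value M m (\<lambda>\<omega>. Fn n \<omega> - F \<omega>) G f (T f)"
      and bound: "\<And>f. norm (T f) \<le> \<epsilon> * norm f" by blast
    have \<Delta>: "?\<Delta> n = T"
      using multiplier_perturbation(2)[OF T] full by (intro ext) simp
    have "bounded_linear T"
    proof (rule bounded_linear_intro[where K = \<epsilon>])
      show "T (x + y) = T x + T y" for x y
        by (rule is_multiplier_value_unique[OF T is_multiplier_value_add[OF T T]])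
      show "T (r *\<^sub>R x) = r *\<^sub>R T x" for r x
        by (rule is_multiplier_value_unique[OF T is_multiplier_value_scaleR[OF T]])
      show "norm (T x) \<le> norm x * \<epsilon>" for x using bound[of x] by (simp add: mult.commute)
    qed
    moreover have "onorm T \<le> \<epsilon>" using \<open>\<epsilon> > 0\<close> bound by (intro onorm_bound) auto
    ultimately show ?case using multiplier_perturbation(1)[OF T] full \<Delta> by simp
  qed
  have "(\<lambda>n. onorm (?\<Delta> n)) \<longlonglongrightarrow> 0" if full: "multiplier_domain M m F G = UNIV"
  proof (rule tendstoI)
    fix e :: real assume "0 < e"
    then have "0 < e / 2" by simp
    from lin[OF full this] show "\<forall>\<^sub>F n in sequentially. dist (onorm (?\<Delta> n)) 0 < e"
    proof eventually_elim
      case (elim n)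
      then show ?case using onorm_pos_le[of "?\<Delta> n"] \<open>0 < e\<close> by (simp add: dist_real_def)
    qed
  qed
  moreover have "\<forall>\<^sub>F n in sequentially. multiplier_domain M m (Fn n) G = UNIV \<and> bounded_linear (?\<Delta> n)"
    if "multiplier_domain M m F G = UNIV"
    using lin[OF that zero_less_one] by eventually_elim simp
  ultimately show ?thesis using conv by (intro conjI allI impI) simp_all
qed

end
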